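(* Let $a\in\mathbb{R}$ and $L>0$. Consider the problem $$u''' + a u' + u^2 u' = 0 \ \text{ on } [0,L], \qquad u(0)=u(L)=u'(L)=0. \qquad ( * )$$ If $aL^2<4\pi^2$, then there exists a nontrivial solution $u$ of $( * )$ with fundamental period $L$, and it is unique up to sign (i.e. the nontrivial solutions of $( * )$ with fundamental period $L$ are exactly $u$ and $-u$). If $aL^2\geq 4\pi^2$, then there is no nontrivial solution of $( * )$ with fundamental period $L$.
   Context: Solutions are real-valued functions $u\in C^3[0,L]$; nontrivial means not identically zero. Any solution of $( * )$ is infinitely smooth and periodic with period $L$, i.e. it extends to an $L$-periodic $C^\infty$ function on $\mathbb{R}$. The fundamental period of a nontrivial periodic function is its minimal positive period; the fundamental period of a solution on $[0,L]$ means that of its $L$-periodic extension to $\mathbb{R}$. *)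

theory Defs
  imports "HOL-Analysis.Analysis" "HOL-Library.Periodic_Fun" "HOL-Library.Real_Mod"
begin

text \<open>
  Functions on the interval are rendered as total functions of which only the values on
  \<open>{0..L}\<close> matter. Derivatives at the two endpoints are one-sided; for \<open>L > 0\<close> the
  functions \<open>u1\<close>, \<open>u2\<close>, \<open>u3\<close> below are uniquely determined on \<open>{0..L}\<close>.
\<close>

definition C3_derivatives ::
    "real \<Rightarrow> (real \<Rightarrow> real) \<Rightarrow> (real \<Rightarrow> real) \<Rightarrow> (real \<Rightarrow> real) \<Rightarrow> (real \<Rightarrow> real) \<Rightarrow> bool" where
  "C3_derivatives L u u1 u2 u3 \<longleftrightarrow>
     (\<forall>x\<in>{0..L}. (u has_real_derivative u1 x) (at x within {0..L})) \<and>
     (\<forall>x\<in>{0..L}. (u1 has_real_derivative u2 x) (at x within {0..L})) \<and>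
     (\<forall>x\<in>{0..L}. (u2 has_real_derivative u3 x) (at x within {0..L})) \<and>
     continuous_on {0..L} u3"

definition is_solution :: "real \<Rightarrow> real \<Rightarrow> (real \<Rightarrow> real) \<Rightarrow> bool" where
  "is_solution a L u \<longleftrightarrow>
     (\<exists>u1 u2 u3. C3_derivatives L u u1 u2 u3 \<and>
        (\<forall>x\<in>{0..L}. u3 x + a * u1 x + (u x)\<^sup>2 * u1 x = 0) \<and>
        u 0 = 0 \<and> u L = 0 \<and> u1 L = 0)"

definition nontrivial_on :: "real \<Rightarrow> (real \<Rightarrow> real) \<Rightarrow> bool" where
  "nontrivial_on L u \<longleftrightarrow> (\<exists>x\<in>{0..L}. u x \<noteq> 0)"

text \<open>
  The value at \<open>L\<close> is discarded here; the extension still agrees with \<open>u\<close> on all of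
  \<open>{0..L}\<close> whenever \<open>u 0 = u L\<close>, which the boundary conditions guarantee.
\<close>

definition periodic_extension :: "real \<Rightarrow> (real \<Rightarrow> real) \<Rightarrow> real \<Rightarrow> real" where
  "periodic_extension L u = (\<lambda>x. u (x rmod L))"

definition is_fundamental_period :: "(real \<Rightarrow> real) \<Rightarrow> real \<Rightarrow> bool" where
  "is_fundamental_period f T \<longleftrightarrow>
     T > 0 \<and> periodic_fun_simple f T \<and> (\<forall>p>0. periodic_fun_simple f p \<longrightarrow> T \<le> p)"

definition nontrivial_solution_with_period_L :: "real \<Rightarrow> real \<Rightarrow> (real \<Rightarrow> real) \<Rightarrow> bool" where
  "nontrivial_solution_with_period_L a L u \<longleftrightarrow>
     is_solution a L u \<and> nontrivial_on L u \<and>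
     is_fundamental_period (periodic_extension L u) L"

end

theory Submission
  imports Defs
begin

text \<open>
  The equation integrates twice. Since \<open>u''' + a u' + u\<^sup>2 u'\<close> is the derivative of \<open>u'' + a u + u\<^sup>3/3\<close>,
  a solution satisfies \<open>u'' = C - a u - u\<^sup>3/3\<close> for some constant \<open>C\<close>. Multiplying by \<open>u'\<close> and
  integrating again gives \<open>u'\<^sup>2/2 + a u\<^sup>2/2 + u\<^sup>4/12 - C u = E\<close>; the boundary conditions at \<open>L\<close> force
  \<open>E = 0\<close>, and then \<open>u(0) = 0\<close> forces \<open>u'(0) = 0\<close> as well (\<open>solution_imp_profile\<close>). So \<open>u\<close> solves a
  second-order initial value problem with zero data and is determined by \<open>C\<close> (\<open>profile_unique\<close>).
  The value \<open>C = 0\<close> gives \<open>u = 0\<close>, and \<open>u \<mapsto> -u\<close> exchanges \<open>C\<close> and \<open>-C\<close>, so let \<open>C > 0\<close>.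

  The first-order equation reads \<open>u'\<^sup>2 = u (2 C - a u - u\<^sup>3/6)\<close>. The cubic factor has exactly one positive
  root \<open>M\<close>, the amplitude, and \<open>u\<close> oscillates between \<open>0\<close> and \<open>M\<close>. Writing \<open>u = M s\<close> with
  \<open>s = (1 - cos \<phi>)/2\<close> removes both turning points: the phase obeys \<open>\<phi>' = F(\<phi>)\<close> with
  \<open>F\<^sup>2 = a + (M\<^sup>2/6)(1 + s + s\<^sup>2)\<close>, which is positive and \<open>2\<pi>\<close>-periodic. The phase therefore increases
  by \<open>2\<pi>\<close> in the time \<open>T(M) = \<integral> 1/F\<close> over \<open>[0, 2\<pi>]\<close>, and \<open>u\<close> is a \<open>T(M)\<close>-periodic function that
  vanishes only at the multiples of \<open>T(M)\<close> (\<open>oscillation_exists\<close>). Hence a solution has fundamental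
  period \<open>L\<close> exactly when \<open>T(M) = L\<close>.

  It remains to find the range of \<open>T\<close> on the amplitudes with \<open>M > 0\<close> and \<open>a + M\<^sup>2/6 > 0\<close>. The integrand
  decreases in \<open>M\<close>, so \<open>T\<close> is injective; it is continuous and tends to \<open>0\<close> for large \<open>M\<close>. If \<open>a > 0\<close>, then
  \<open>F > \<surd>a\<close> gives \<open>T < 2\<pi>/\<surd>a\<close>, a bound approached for small \<open>M\<close>. If \<open>a \<le> 0\<close>, then \<open>T\<close> is unbounded
  because, as \<open>a + M\<^sup>2/6\<close> tends to \<open>0\<close>, \<open>1/F\<close> becomes at least of order \<open>1/\<phi>\<close> near \<open>\<phi> = 0\<close>. In both cases
  \<open>L\<close> is a value of \<open>T\<close> if and only if \<open>a L\<^sup>2 < 4 \<pi>\<^sup>2\<close> (\<open>wave_period_bound\<close>, \<open>wave_period_surj\<close>).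
\<close>

section \<open>Periodic flows on the line\<close>

text \<open>
  Separation of variables: the inverse \<open>G\<close> of the flow is the antiderivative of \<open>1/F\<close>. Periodicity of
  \<open>F\<close> makes \<open>G (t + P) - G t\<close> constant, and this constant is the time \<open>T\<close> of one turn.
\<close>

lemma periodic_autonomous_flow:
  fixes F :: "real \<Rightarrow> real" and P :: real
  assumes cont: "continuous_on UNIV F" and pos: "\<And>t. F t > 0"
    and per: "\<And>t. F (t + P) = F t" and P: "P > 0"
  defines "T \<equiv> integral {0..P} (\<lambda>t. 1 / F t)"
  obtains p where "p 0 = 0" "\<And>x. (p has_real_derivative F (p x)) (at x)"
    "\<And>x. p (x + T) = p x + P" "strict_mono p" "T > 0"
proof -
  have isC: "isCont (\<lambda>t. 1 / F t) t" for t
    using cont pos[of t] by (auto simp: continuous_on_eq_continuous_at intro!: continuous_intros)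
  obtain G0 where G0: "\<And>t. (G0 has_real_derivative 1 / F t) (at t)"
    using einterval_antiderivative[of "-\<infinity>" "\<infinity>" "\<lambda>t. 1 / F t"] isC
    by (auto simp: has_real_derivative_iff_has_vector_derivative)
  define G where "G t = G0 t - G0 0" for t
  have G: "(G has_real_derivative 1 / F t) (at t)" for t
    unfolding G_def by (auto intro!: derivative_eq_intros G0)
  have G_0: "G 0 = 0" by (simp add: G_def)
  have Gmono: "strict_mono G"
    by (rule strict_monoI, rule DERIV_pos_imp_increasing) (use G pos in \<open>auto intro!: exI\<close>)
  have "((\<lambda>t. 1 / F t) has_integral G P - G 0) {0..P}"
    using P G by (intro fundamental_theorem_of_calculus)
      (auto simp: has_real_derivative_iff_has_vector_derivative
            intro: has_vector_derivative_at_within)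
  then have GP: "G P = T" by (simp add: T_def G_0 integral_unique)
  then have T: "T > 0" using strict_monoD[OF Gmono P] by (simp add: G_0)
  have Gshift: "G (t + P) = G t + T" for t
  proof -
    have "((\<lambda>t. G (t + P) - G t) has_real_derivative 0) (at t)" for t
      using DERIV_diff[OF DERIV_shift[THEN iffD1, OF G[of "t + P"]] G[of t]] by (simp add: per)
    then have "G (t + P) - G t = G (0 + P) - G 0"
      by (intro DERIV_isconst_all[of "\<lambda>t. G (t + P) - G t"]) auto
    then show ?thesis by (simp add: GP G_0)
  qed
  have Gnat: "G (real k * P) = real k * T" for k
    by (induction k) (simp_all add: G_0 ring_distribs Gshift add.commute[of P])
  have Gneg: "G (- (real k * P)) = - (real k * T)" for k
  proof (induction k)
    case (Suc k)
    show ?case using Gshift[of "- (real (Suc k) * P)"] Suc by (simp add: algebra_simps)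
  qed (simp add: G_0)
  have contG: "isCont G t" for t using G DERIV_isCont by blast
  have "\<exists>t. G t = y" for y
  proof -
    obtain k where k: "\<bar>y\<bar> < real k * T" using reals_Archimedean3[OF T] by blast
    have "\<exists>t\<ge>- (real k * P). t \<le> real k * P \<and> G t = y"
      by (rule IVT) (use k P contG in \<open>auto simp: Gnat Gneg intro: order_trans\<close>)
    then show ?thesis by blast
  qed
  then have "surj G" by (metis surjI)
  define p where "p = inv G"
  have Gp: "G (p x) = x" for x using \<open>surj G\<close> by (simp add: p_def surj_f_inv_f)
  have pG: "p (G t) = t" for t using Gmono by (simp add: p_def strict_mono_imp_inj_on)
  have contp: "isCont p x" for x
    using isCont_inverse_function[of 1 "p x" p G] by (simp add: pG contG Gp)
  show thesis
  proof
    show "p 0 = 0" using pG[of 0] by (simp add: G_0)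
    show "(p has_real_derivative F (p x)) (at x)" for x
      using DERIV_inverse_function[OF G, of p x "x - 1" "x + 1"] pos[of "p x"]
      by (simp add: Gp contp)
    show "p (x + T) = p x + P" for x
      using pG[of "p x + P"] by (simp add: Gshift Gp)
    show "strict_mono p"
      by (rule strict_monoI) (metis Gmono Gp strict_mono_less)
  qed (rule T)
qed

section \<open>The twice integrated equation\<close>

text \<open>
  The twice integrated problem: the additive constant \<open>C\<close> comes from the first integration, and both
  initial values vanish. The derivative \<open>u1\<close> is a parameter because at the endpoints it is
  one-sided and depends on the interval.
\<close>

definition profile_on ::
    "real \<Rightarrow> real \<Rightarrow> real \<Rightarrow> (real \<Rightarrow> real) \<Rightarrow> (real \<Rightarrow> real) \<Rightarrow> bool" where
  "profile_on L a C u u1 \<longleftrightarrow>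
     (\<forall>x\<in>{0..L}. (u has_real_derivative u1 x) (at x within {0..L})) \<and>
     (\<forall>x\<in>{0..L}. (u1 has_real_derivative C - a * u x - (u x)^3 / 3) (at x within {0..L})) \<and>
     u 0 = 0 \<and> u1 0 = 0"

text \<open>
  The difference \<open>w\<close> of two profiles solves a linear equation \<open>w'' = (q - 1) w\<close> with \<open>q\<close> bounded by some
  \<open>K\<close> on the interval. So \<open>E = w\<^sup>2 + w'\<^sup>2\<close> satisfies \<open>E' = 2 w w' q \<le> K E\<close>, and \<open>E exp (-K t)\<close> is
  nonincreasing and starts at \<open>0\<close>.
\<close>

lemma profile_unique:
  assumes pu: "profile_on L a C u u1" and pv: "profile_on L a C v v1" and x: "x \<in> {0..L}"
  shows "u x = v x"
proof -
  have u: "(u has_real_derivative u1 x) (at x within {0..L})"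
      "(u1 has_real_derivative C - a * u x - (u x)^3 / 3) (at x within {0..L})"
    and v: "(v has_real_derivative v1 x) (at x within {0..L})"
      "(v1 has_real_derivative C - a * v x - (v x)^3 / 3) (at x within {0..L})"
    if "x \<in> {0..L}" for x
    using pu pv that unfolding profile_on_def by blast+
  have init: "u 0 = v 0" "u1 0 = v1 0"
    using pu pv by (simp_all add: profile_on_def)
  have cont: "continuous_on {0..L} u" "continuous_on {0..L} v"
      "continuous_on {0..L} u1" "continuous_on {0..L} v1"
    by (rule DERIV_continuous_on, erule u v)+
  define q where "q t = 1 - a - ((u t)\<^sup>2 + u t * v t + (v t)\<^sup>2) / 3" for t
  have "compact (q ` {0..L})"
    unfolding q_def by (intro compact_continuous_image continuous_intros cont) auto
  then obtain K where "\<forall>y\<in>q ` {0..L}. \<bar>y\<bar> \<le> K"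
    by (auto dest!: compact_imp_bounded simp: bounded_iff)
  then have K: "\<bar>q t\<bar> \<le> K" if "t \<in> {0..L}" for t using that by blast
  define E where "E t = (u t - v t)\<^sup>2 + (u1 t - v1 t)\<^sup>2" for t
  define H where "H t = E t * exp (- (K * t))" for t
  have Hderiv: "(H has_real_derivative
      (2 * (u t - v t) * (u1 t - v1 t) * q t - K * E t) * exp (- (K * t))) (at t within {0..L})"
    if t: "t \<in> {0..L}" for t
    unfolding H_def E_def q_def
    by (rule derivative_eq_intros u[OF t] v[OF t] refl)+
      (auto simp: field_simps power2_eq_square power3_eq_cube)
  have slope: "2 * (u t - v t) * (u1 t - v1 t) * q t - K * E t \<le> 0" if t: "t \<in> {0..L}" for t
  proof -
    define z where "z = 2 * (u t - v t) * (u1 t - v1 t)"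
    have "\<bar>z\<bar> \<le> E t"
      using zero_le_power2[of "(u t - v t) - (u1 t - v1 t)"]
        zero_le_power2[of "(u t - v t) + (u1 t - v1 t)"]
      unfolding E_def z_def abs_le_iff power2_diff power2_sum by linarith
    then have "\<bar>z\<bar> * \<bar>q t\<bar> \<le> E t * K" using K[OF t] by (intro mult_mono) auto
    then show ?thesis using abs_ge_self[of "z * q t"] by (simp add: z_def abs_mult mult.commute)
  qed
  have "H x \<le> H 0"
  proof (rule DERIV_nonpos_imp_decreasing_open[where f = H])
    show "continuous_on {0..x} H"
      using x DERIV_continuous_on[OF Hderiv] by (auto elim: continuous_on_subset)
    fix t assume t: "0 < t" "t < x"
    then have "at t within {0..L} = at t" using x by (intro at_within_interior) auto
    then show "\<exists>y. (H has_real_derivative y) (at t) \<and> y \<le> 0"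
      using Hderiv[of t] slope[of t] t x by (auto simp: mult_le_0_iff intro!: exI)
  qed (use x in auto)
  also have "H 0 = 0" by (simp add: H_def E_def init)
  finally have "E x \<le> 0" by (simp add: H_def mult_le_0_iff)
  then show ?thesis
    using zero_le_power2[of "u x - v x"] zero_le_power2[of "u1 x - v1 x"]
    unfolding E_def by (smt (verit) zero_eq_power2)
qed

lemma profile_on_uminus:
  assumes "profile_on L a C u u1"
  shows "profile_on L a (- C) (\<lambda>x. - u x) (\<lambda>x. - u1 x)"
  using assms unfolding profile_on_def by (auto intro!: derivative_eq_intros)

lemma profile_on_zero: "profile_on L a 0 (\<lambda>x. 0) (\<lambda>x. 0)"
  by (simp add: profile_on_def)

text \<open>
  Two first integrals. The value of the second one at \<open>L\<close> is \<open>0\<close> by the boundary conditions, and at \<open>0\<close>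
  it is \<open>(u'(0))\<^sup>2/2\<close>; this yields the missing initial condition \<open>u'(0) = 0\<close>.
\<close>

lemma solution_imp_profile:
  assumes L: "L > 0" and sol: "is_solution a L u"
  obtains C u1 where "profile_on L a C u u1"
proof -
  obtain u1 u2 u3 where d: "\<And>x. x \<in> {0..L} \<Longrightarrow> (u has_real_derivative u1 x) (at x within {0..L})"
      "\<And>x. x \<in> {0..L} \<Longrightarrow> (u1 has_real_derivative u2 x) (at x within {0..L})"
      "\<And>x. x \<in> {0..L} \<Longrightarrow> (u2 has_real_derivative u3 x) (at x within {0..L})"
    and eq: "\<And>x. x \<in> {0..L} \<Longrightarrow> u3 x + a * u1 x + (u x)\<^sup>2 * u1 x = 0"
    and bc: "u 0 = 0" "u L = 0" "u1 L = 0"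
    using sol unfolding is_solution_def C3_derivatives_def by blast
  have "\<exists>C. \<forall>x\<in>{0..L}. u2 x + a * u x + (u x)^3 / 3 = C"
  proof (rule has_field_derivative_zero_constant)
    fix x assume x: "x \<in> {0..L}"
    show "((\<lambda>x. u2 x + a * u x + (u x)^3 / 3) has_real_derivative 0) (at x within {0..L})"
      using eq[OF x] by (auto intro!: derivative_eq_intros d[OF x] simp: algebra_simps)
  qed simp
  then obtain C where C: "\<And>x. x \<in> {0..L} \<Longrightarrow> u2 x = C - a * u x - (u x)^3 / 3"
    by (auto simp: algebra_simps)
  have "\<exists>E. \<forall>x\<in>{0..L}. (u1 x)\<^sup>2 / 2 + a * (u x)\<^sup>2 / 2 + (u x)^4 / 12 - C * u x = E"
  proof (rule has_field_derivative_zero_constant)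
    fix x assume x: "x \<in> {0..L}"
    show "((\<lambda>x. (u1 x)\<^sup>2 / 2 + a * (u x)\<^sup>2 / 2 + (u x)^4 / 12 - C * u x)
        has_real_derivative 0) (at x within {0..L})"
      by (auto intro!: derivative_eq_intros d[OF x]
          simp: C[OF x] field_simps power2_eq_square power3_eq_cube)
  qed simp
  then obtain E where E:
    "\<And>x. x \<in> {0..L} \<Longrightarrow> (u1 x)\<^sup>2 / 2 + a * (u x)\<^sup>2 / 2 + (u x)^4 / 12 - C * u x = E"
    by blast
  have "u1 0 = 0" using E[of 0] E[of L] L by (simp add: bc)
  then have "profile_on L a C u u1"
    unfolding profile_on_def using d(1,2) C bc by auto
  then show thesis by (rule that)
qed

lemma profile_imp_solution:
  assumes prof: "profile_on L a C u u1" and bc: "u L = 0" "u1 L = 0"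
  shows "is_solution a L u"
proof -
  have d: "(u has_real_derivative u1 x) (at x within {0..L})"
      "(u1 has_real_derivative C - a * u x - (u x)^3 / 3) (at x within {0..L})"
    if "x \<in> {0..L}" for x
    using prof that unfolding profile_on_def by blast+
  have "((\<lambda>x. C - a * u x - (u x)^3 / 3) has_real_derivative - a * u1 x - (u x)\<^sup>2 * u1 x)
      (at x within {0..L})" if "x \<in> {0..L}" for x
    by (auto intro!: derivative_eq_intros d[OF that] simp: power2_eq_square)
  moreover have "continuous_on {0..L} (\<lambda>x. - a * u1 x - (u x)\<^sup>2 * u1 x)"
    by (intro continuous_intros; rule DERIV_continuous_on, erule d)
  ultimately show ?thesis
    unfolding is_solution_def C3_derivatives_def
    using d bc prof
    by (intro exI[of _ u1] exI[of _ "\<lambda>x. C - a * u x - (u x)^3 / 3"]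
        exI[of _ "\<lambda>x. - a * u1 x - (u x)\<^sup>2 * u1 x"]) (auto simp: profile_on_def)
qed

section \<open>The oscillation of given amplitude\<close>

text \<open>
  The height of the oscillation relative to its amplitude, as a function of the phase; equal to
  \<open>sin\<^sup>2 (t/2)\<close>.
\<close>

definition rise :: "real \<Rightarrow> real" where
  "rise t = (1 - cos t) / 2"

text \<open>
  The radicand is what remains of \<open>2 C - a u - u\<^sup>3/6\<close> at \<open>u = M s\<close> after division by \<open>M (1 - s)\<close>, when
  \<open>M\<close> is the root of this cubic, that is, when \<open>2 C = a M + M\<^sup>3/6\<close>.
\<close>

definition phase_speed :: "real \<Rightarrow> real \<Rightarrow> real \<Rightarrow> real" where
  "phase_speed a M t = sqrt (a + M\<^sup>2 / 6 * (1 + rise t + (rise t)\<^sup>2))"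

definition wave_period :: "real \<Rightarrow> real \<Rightarrow> real" where
  "wave_period a M = integral {0..2 * pi} (\<lambda>t. 1 / phase_speed a M t)"

lemma rise_bounds: "0 \<le> rise t" "rise t \<le> 1"
  unfolding rise_def using cos_le_one[of t] cos_ge_minus_one[of t] by auto

lemma rise_pos: "0 < t \<Longrightarrow> t < 2 * pi \<Longrightarrow> 0 < rise t"
proof -
  assume t: "0 < t" "t < 2 * pi"
  have "sin (t / 2) > 0" using t by (intro sin_gt_zero) auto
  moreover have "rise t = (sin (t / 2))\<^sup>2"
    using cos_double_sin[of "t / 2"] by (simp add: rise_def)
  ultimately show ?thesis by simp
qed

lemma rise_le_quadratic: "rise t \<le> t\<^sup>2 / 4"
proof -
  have "\<bar>sin (t / 2)\<bar> \<le> \<bar>t / 2\<bar>" by (rule abs_sin_x_le_abs_x)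
  then have "(sin (t / 2))\<^sup>2 \<le> (t / 2)\<^sup>2" by (rule abs_le_square_iff[THEN iffD1])
  then show ?thesis using cos_double_sin[of "t / 2"] by (simp add: rise_def power_divide)
qed

text \<open>
  The condition \<open>a + M\<^sup>2/6 > 0\<close>, carried by most lemmas below, says by this bound that the phase never
  stops. It is equivalent to \<open>C > 0\<close> for \<open>M > 0\<close>.
\<close>

lemma phase_speed_radicand_ge:
  "a + M\<^sup>2 / 6 \<le> a + M\<^sup>2 / 6 * (1 + rise t + (rise t)\<^sup>2)"
proof -
  have "M\<^sup>2 / 6 * 1 \<le> M\<^sup>2 / 6 * (1 + rise t + (rise t)\<^sup>2)"
    using rise_bounds[of t] by (intro mult_left_mono) auto
  then show ?thesis by simp
qed

lemma phase_speed_pos: "0 < a + M\<^sup>2 / 6 \<Longrightarrow> 0 < phase_speed a M t"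
  unfolding phase_speed_def using phase_speed_radicand_ge[of a M t] by simp

lemma continuous_on_phase_speed [continuous_intros]: "continuous_on A (phase_speed a M)"
  unfolding phase_speed_def rise_def by (intro continuous_intros) auto

lemma global_profile_on:
  assumes "\<And>x. (w has_real_derivative w1 x) (at x)"
    "\<And>x. (w1 has_real_derivative C - a * w x - (w x)^3 / 3) (at x)" "w 0 = 0" "w1 0 = 0"
  shows "profile_on L a C w w1"
  unfolding profile_on_def using assms by (auto intro: has_field_derivative_at_within)

text \<open>
  The candidate is \<open>w = M rise(p)\<close> for the flow \<open>p\<close> of the phase speed. Its zeros are the times at which
  the phase is a multiple of \<open>2\<pi>\<close>, so it does not vanish inside a period.
\<close>

lemma oscillation_exists:
  fixes a M :: real
  assumes M: "M > 0" and adm: "0 < a + M\<^sup>2 / 6"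
  defines "C \<equiv> (a * M + M^3 / 6) / 2" and "T \<equiv> wave_period a M"
  obtains w w1 where
    "\<And>x. (w has_real_derivative w1 x) (at x)"
    "\<And>x. (w1 has_real_derivative C - a * w x - (w x)^3 / 3) (at x)"
    "w 0 = 0" "w1 0 = 0" "T > 0" "\<And>x. w (x + T) = w x" "\<And>x. w1 (x + T) = w1 x"
    "\<And>x. 0 < x \<Longrightarrow> x < T \<Longrightarrow> w x \<noteq> 0"
proof -
  have per: "phase_speed a M (t + 2 * pi) = phase_speed a M t" for t
    by (simp add: phase_speed_def rise_def)
  obtain p where p: "p 0 = 0" "\<And>x. (p has_real_derivative phase_speed a M (p x)) (at x)"
      "\<And>x. p (x + T) = p x + 2 * pi" "strict_mono p" "T > 0"
    using periodic_autonomous_flow[OF continuous_on_phase_speed phase_speed_pos[OF adm] per]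
    unfolding T_def wave_period_def by auto
  define w where "w x = M * rise (p x)" for x
  define w1 where "w1 x = M / 2 * sin (p x) * phase_speed a M (p x)" for x
  have rad: "0 < a + M\<^sup>2 / 6 * (1 + rise t + (rise t)\<^sup>2)" for t
    using phase_speed_radicand_ge[of a M t] adm by linarith
  have drise: "(rise has_real_derivative sin t / 2) (at t)" for t
    unfolding rise_def by (auto intro!: derivative_eq_intros)
  have dspeed: "(phase_speed a M has_real_derivative
      M\<^sup>2 / 24 * (1 + 2 * rise t) * sin t / phase_speed a M t) (at t)" for t
    unfolding phase_speed_def using rad[of t]
    by (auto intro!: derivative_eq_intros drise simp: field_simps)
  show thesis
  proof
    show "(w has_real_derivative w1 x) (at x)" for x
      unfolding w_def w1_def
      by (rule derivative_eq_intros DERIV_chain2[OF drise p(2)] refl)+ simp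
    show "(w1 has_real_derivative C - a * w x - (w x)^3 / 3) (at x)" for x
    proof -
      define s where "s = rise (p x)"
      have pos: "phase_speed a M (p x) > 0" using phase_speed_pos[OF adm] .
      have sq: "(phase_speed a M (p x))\<^sup>2 = a + M\<^sup>2 / 6 * (1 + s + s\<^sup>2)"
        unfolding phase_speed_def s_def using rad[of "p x"] by simp
      have cos: "cos (p x) = 1 - 2 * s" by (simp add: s_def rise_def diff_divide_distrib)
      have sin: "(sin (p x))\<^sup>2 = 4 * s * (1 - s)"
        using sin_squared_eq[of "p x"] by (simp add: cos power2_eq_square algebra_simps)
      \<comment> \<open>The derivative of the phase speed along the flow is \<open>(F\<^sup>2)'/2\<close>, so square roots
        cancel and a polynomial in \<open>s\<close> remains.\<close>
      have "(w1 has_real_derivative M / 2 * (cos (p x) * (phase_speed a M (p x))\<^sup>2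
          + M\<^sup>2 / 24 * (1 + 2 * s) * (sin (p x))\<^sup>2)) (at x)"
        unfolding w1_def s_def
        by (rule derivative_eq_intros DERIV_chain2[OF dspeed p(2)] p(2) refl)+
          (use pos in \<open>simp add: field_simps power2_eq_square\<close>)
      also have "M / 2 * (cos (p x) * (phase_speed a M (p x))\<^sup>2
          + M\<^sup>2 / 24 * (1 + 2 * s) * (sin (p x))\<^sup>2) = C - a * w x - (w x)^3 / 3"
        unfolding sq cos sin C_def w_def s_def[symmetric]
        by (simp add: field_simps power2_eq_square power3_eq_cube)
      finally show ?thesis .
    qed
    show "w 0 = 0" "w1 0 = 0" by (simp_all add: w_def w1_def rise_def p)
    show "w (x + T) = w x" "w1 (x + T) = w1 x" for x
      by (simp_all add: w_def w1_def p(3) per) (simp add: rise_def)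
    show "w x \<noteq> 0" if "0 < x" "x < T" for x
    proof -
      have "p 0 < p x" "p x < p (0 + T)"
        using that strict_monoD[OF p(4)] by auto
      then have "0 < rise (p x)" unfolding p(3) p(1) by (intro rise_pos) auto
      then show ?thesis using M by (simp add: w_def)
    qed
  qed (rule p(5))
qed

section \<open>The period as a function of the amplitude\<close>

lemma wave_period_strict_antimono:
  assumes "0 < M" "M < N" "0 < a + M\<^sup>2 / 6"
  shows "wave_period a N < wave_period a M"
proof -
  have MN: "M\<^sup>2 < N\<^sup>2" using assms by (intro power_strict_mono) auto
  then have N: "0 < a + N\<^sup>2 / 6" using assms by simp
  have "phase_speed a M t < phase_speed a N t" for t
    unfolding phase_speed_def using MN rise_bounds[of t]
    by (auto intro!: mult_strict_right_mono divide_strict_right_mono add_pos_nonneg)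
  then show ?thesis
    unfolding wave_period_def using phase_speed_pos[OF N] phase_speed_pos[OF assms(3)]
    by (intro integral_less_real continuous_intros divide_strict_left_mono)
      (auto simp: less_imp_neq[THEN not_sym] not_le)
qed

text \<open>
  For \<open>a > 0\<close> the phase is faster than that of the linearised equation \<open>u'' + a u = C\<close>, whose period
  is \<open>2\<pi>/\<surd>a\<close>; for \<open>a \<le> 0\<close> the bound is a matter of sign.
\<close>

lemma wave_period_bound:
  assumes "0 < M" "0 < a + M\<^sup>2 / 6"
  shows "a * (wave_period a M)\<^sup>2 < 4 * pi\<^sup>2"
proof (cases "a > 0")
  case True
  have "wave_period a M < integral {0..2 * pi} (\<lambda>t. 1 / sqrt a)"
    unfolding wave_period_def
  proof (intro integral_less_real continuous_intros divide_strict_left_mono)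
    fix t assume "t \<in> {0<..<2 * pi}"
    have "0 < M\<^sup>2 / 6" using assms by simp
    moreover have "M\<^sup>2 / 6 * 1 \<le> M\<^sup>2 / 6 * (1 + rise t + (rise t)\<^sup>2)"
      using rise_bounds[of t] by (intro mult_left_mono) auto
    ultimately show "sqrt a < phase_speed a M t" by (simp add: phase_speed_def)
  qed (use phase_speed_pos[OF assms(2)] True in \<open>auto simp: less_imp_neq[THEN not_sym] not_le\<close>)
  also have "\<dots> = 2 * pi / sqrt a" by simp
  finally have "wave_period a M < 2 * pi / sqrt a" .
  moreover have "0 \<le> wave_period a M"
    unfolding wave_period_def using phase_speed_pos[OF assms(2)]
    by (intro integral_nonneg integrable_continuous_real continuous_intros)
      (auto simp: less_imp_neq[THEN not_sym] less_imp_le)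
  ultimately have "(wave_period a M)\<^sup>2 < (2 * pi / sqrt a)\<^sup>2" by (intro power_strict_mono) auto
  then show ?thesis using True by (simp add: field_simps power2_eq_square)
next
  case False
  then have "a * (wave_period a M)\<^sup>2 \<le> 0" by (simp add: mult_le_0_iff)
  then show ?thesis by (smt (verit) pi_gt_zero zero_less_power)
qed

lemma continuous_on_wave_period:
  assumes "\<And>M. M \<in> S \<Longrightarrow> 0 < a + M\<^sup>2 / 6"
  shows "continuous_on S (wave_period a)"
proof -
  have "continuous_on S (\<lambda>M. integral (cbox 0 (2 * pi)) (\<lambda>t. 1 / phase_speed a M t))"
  proof (rule integral_continuous_on_param)
    have "a + M\<^sup>2 / 6 * (1 + rise t + (rise t)\<^sup>2) \<noteq> 0" if "M \<in> S" for M t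
      using assms[OF that] phase_speed_radicand_ge[of a M t] by linarith
    then show "continuous_on (S \<times> cbox 0 (2 * pi)) (\<lambda>(M, t). 1 / phase_speed a M t)"
      unfolding phase_speed_def rise_def case_prod_unfold
      by (intro continuous_intros) (auto simp: case_prod_unfold)
  qed
  then show ?thesis by (simp add: wave_period_def[abs_def])
qed

lemma phase_speed_le:
  assumes adm: "0 < a + M\<^sup>2 / 6"
    and le: "a + M\<^sup>2 / 6 * (1 + rise t + (rise t)\<^sup>2) \<le> b\<^sup>2" and b: "0 < b"
  shows "1 / b \<le> 1 / phase_speed a M t"
proof -
  have "phase_speed a M t \<le> b"
    unfolding phase_speed_def using le b by (intro real_le_lsqrt) auto
  then show ?thesis using phase_speed_pos[OF adm, of t] by (intro divide_left_mono) auto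
qed

lemma integrable_inverse_phase_speed:
  assumes "0 < a + M\<^sup>2 / 6"
  shows "(\<lambda>t. 1 / phase_speed a M t) integrable_on {0..2 * pi}"
  using phase_speed_pos[OF assms]
  by (intro integrable_continuous_real continuous_intros) (auto simp: less_imp_neq[THEN not_sym])

text \<open>
  Take \<open>M\<close> with \<open>a + M\<^sup>2/6 = d\<^sup>2\<close> for a small \<open>d\<close>. Since \<open>rise t\<close> is at most quadratic at \<open>0\<close>, the phase
  speed is at most \<open>d + K t\<close> with \<open>K\<close> independent of \<open>d\<close>, and the period is at least
  \<open>ln (1 + 2 \<pi> K / d) / K\<close>, which exceeds every bound as \<open>d\<close> tends to \<open>0\<close>.
\<close>

lemma wave_period_unbounded:
  assumes "a \<le> 0"
  obtains M where "M > 0" "0 < a + M\<^sup>2 / 6" "L \<le> wave_period a M"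
proof -
  define K where "K = sqrt ((1 - a) / 2)"
  have K: "K > 0" "K\<^sup>2 = (1 - a) / 2" using assms by (auto simp: K_def)
  \<comment> \<open>chosen so that \<open>ln d \<le> ln (2 \<pi> K) - K L\<close>; the bound \<open>d \<le> 1\<close> gives \<open>(d\<^sup>2 - a)/2 \<le> K\<^sup>2\<close>\<close>
  define d where "d = min 1 (2 * pi * K * exp (- (K * L)))"
  have d: "0 < d" "d \<le> 1" using K by (auto simp: d_def)
  have d2: "d\<^sup>2 \<le> 1" using d by (simp add: power_le_one)
  define M where "M = sqrt (6 * (d\<^sup>2 - a))"
  have "d\<^sup>2 - a > 0" using d assms by (smt (verit) zero_less_power)
  then have M: "M > 0" "M\<^sup>2 / 6 = d\<^sup>2 - a" by (auto simp: M_def)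
  then have adm: "0 < a + M\<^sup>2 / 6" unfolding M(2) using d by simp
  have lower: "1 / (d + K * t) \<le> 1 / phase_speed a M t" if t: "t \<in> {0..2 * pi}" for t
  proof (rule phase_speed_le[OF adm])
    have "(rise t)\<^sup>2 \<le> rise t"
      using rise_bounds[of t] by (simp add: power2_eq_square mult_left_le)
    then have "rise t + (rise t)\<^sup>2 \<le> t\<^sup>2 / 2" using rise_le_quadratic[of t] by linarith
    then have "(d\<^sup>2 - a) * (rise t + (rise t)\<^sup>2) \<le> (1 - a) * (t\<^sup>2 / 2)"
      using d2 assms rise_bounds[of t] by (intro mult_mono) auto
    moreover have "(d\<^sup>2 - a) * (1 + rise t + (rise t)\<^sup>2)
        = (d\<^sup>2 - a) + (d\<^sup>2 - a) * (rise t + (rise t)\<^sup>2)"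
      by (simp add: algebra_simps)
    ultimately have "a + M\<^sup>2 / 6 * (1 + rise t + (rise t)\<^sup>2) \<le> d\<^sup>2 + K\<^sup>2 * t\<^sup>2"
      unfolding M(2) K(2) by simp
    also have "\<dots> \<le> (d + K * t)\<^sup>2"
      using d K t by (simp add: power2_sum power_mult_distrib)
    finally show "a + M\<^sup>2 / 6 * (1 + rise t + (rise t)\<^sup>2) \<le> (d + K * t)\<^sup>2" .
    show "0 < d + K * t" using d K t by (intro add_pos_nonneg) auto
  qed
  have primitive: "((\<lambda>t. 1 / (d + K * t)) has_integral
      ln (d + K * (2 * pi)) / K - ln (d + K * 0) / K) {0..2 * pi}"
  proof (rule fundamental_theorem_of_calculus)
    fix t assume "t \<in> {0..2 * pi}"
    then have "0 < d + K * t" using d K by (intro add_pos_nonneg) auto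
    then have "((\<lambda>t. ln (d + K * t) / K) has_real_derivative 1 / (d + K * t)) (at t)"
      using K by (auto intro!: derivative_eq_intros)
    then show "((\<lambda>t. ln (d + K * t) / K) has_vector_derivative 1 / (d + K * t))
        (at t within {0..2 * pi})"
      by (simp add: has_real_derivative_iff_has_vector_derivative has_vector_derivative_at_within)
  qed simp
  have "ln d \<le> ln (2 * pi * K * exp (- (K * L)))"
    using d K by (subst ln_le_cancel_iff) (auto simp: d_def)
  also have "\<dots> = ln (2 * pi * K) - K * L" using K by (simp add: ln_mult)
  also have "\<dots> \<le> ln (d + K * (2 * pi)) - K * L" using d K by (simp add: ac_simps add_pos_pos)
  finally have "L \<le> ln (d + K * (2 * pi)) / K - ln (d + K * 0) / K"
    using K by (simp add: field_simps)
  also have "\<dots> = integral {0..2 * pi} (\<lambda>t. 1 / (d + K * t))"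
    using primitive by (rule integral_unique[symmetric])
  also have "\<dots> \<le> wave_period a M"
    unfolding wave_period_def using primitive integrable_inverse_phase_speed[OF adm] lower
    by (intro integral_le) (auto simp: integrable_on_def)
  finally show thesis using that M adm by blast
qed

text \<open>
  Intermediate values. With \<open>b = 2\<pi>/L\<close>, comparing the phase speed with the constant \<open>b\<close> compares the
  period with \<open>L\<close>. The hypothesis says \<open>a < b\<^sup>2\<close>, so some amplitude makes the least value
  \<open>a + M\<^sup>2/6\<close> of the radicand equal to \<open>b\<^sup>2\<close>; its period is at most \<open>L\<close>. A period of at least \<open>L\<close> comes
  for \<open>a > 0\<close> from making the greatest value \<open>a + M\<^sup>2/2\<close> equal to \<open>b\<^sup>2\<close>, and for \<open>a \<le> 0\<close> from the
  unboundedness of the period.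
\<close>

lemma wave_period_surj:
  assumes L: "L > 0" and subcritical: "a * L\<^sup>2 < 4 * pi\<^sup>2"
  obtains M where "M > 0" "0 < a + M\<^sup>2 / 6" "wave_period a M = L"
proof -
  define b where "b = 2 * pi / L"
  have b: "b > 0" using L by (simp add: b_def)
  have ab: "a < b\<^sup>2" using subcritical L by (simp add: b_def field_simps power2_eq_square)
  have int_b: "integral {0..2 * pi} (\<lambda>t. 1 / b) = L" using L by (simp add: b_def)
  obtain M0 where M0: "M0 > 0" "0 < a + M0\<^sup>2 / 6" "L \<le> wave_period a M0"
  proof (cases "a \<le> 0")
    case False
    \<comment> \<open>the greatest value of the radicand, attained at \<open>rise t = 1\<close>, is \<open>b\<^sup>2\<close>\<close>
    define M where "M = sqrt (2 * (b\<^sup>2 - a))"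
    have M: "M > 0" "M\<^sup>2 / 6 = (b\<^sup>2 - a) / 3" using ab by (auto simp: M_def)
    then have adm: "0 < a + M\<^sup>2 / 6" unfolding M(2) using False ab by (intro add_pos_pos) auto
    have "integral {0..2 * pi} (\<lambda>t. 1 / b) \<le> wave_period a M"
      unfolding wave_period_def
    proof (rule integral_le)
      show "1 / b \<le> 1 / phase_speed a M t" for t
      proof (rule phase_speed_le[OF adm _ b])
        have "(rise t)\<^sup>2 \<le> 1" using rise_bounds[of t] by (simp add: power_le_one)
        then have "(b\<^sup>2 - a) / 3 * (1 + rise t + (rise t)\<^sup>2) \<le> (b\<^sup>2 - a) / 3 * 3"
          using ab rise_bounds[of t] by (intro mult_left_mono) auto
        then show "a + M\<^sup>2 / 6 * (1 + rise t + (rise t)\<^sup>2) \<le> b\<^sup>2" unfolding M(2) by simp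
      qed
    qed (use integrable_inverse_phase_speed[OF adm] in auto)
    then show thesis using that M adm int_b by simp
  qed (use wave_period_unbounded in blast)
  \<comment> \<open>the least value of the radicand, attained at \<open>rise t = 0\<close>, is \<open>b\<^sup>2\<close>\<close>
  define M1 where "M1 = sqrt (6 * (b\<^sup>2 - a))"
  have M1: "M1 > 0" "a + M1\<^sup>2 / 6 = b\<^sup>2" using ab by (auto simp: M1_def diff_divide_distrib)
  have adm1: "0 < a + M1\<^sup>2 / 6" using M1 b by simp
  have "wave_period a M1 \<le> integral {0..2 * pi} (\<lambda>t. 1 / b)"
    unfolding wave_period_def
  proof (rule integral_le)
    show "1 / phase_speed a M1 t \<le> 1 / b" for t
    proof -
      have "b \<le> phase_speed a M1 t"
        unfolding phase_speed_def using phase_speed_radicand_ge[of a M1 t] M1(2) b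
        by (intro real_le_rsqrt) auto
      then show ?thesis using b by (intro divide_left_mono) auto
    qed
  qed (use integrable_inverse_phase_speed[OF adm1] in auto)
  then have le: "wave_period a M1 \<le> L" by (simp only: int_b)
  then have "M0 \<le> M1"
    using wave_period_strict_antimono[OF M1(1) _ adm1, of M0] M0 by linarith
  have adm: "0 < a + M\<^sup>2 / 6" if "M \<in> {M0..M1}" for M
  proof -
    have "M0\<^sup>2 \<le> M\<^sup>2" using that M0 by (intro power_mono) auto
    then show ?thesis using M0(2) by linarith
  qed
  obtain M where "M0 \<le> M" "M \<le> M1" "wave_period a M = L"
    using IVT2'[OF le M0(3) \<open>M0 \<le> M1\<close> continuous_on_wave_period] adm by blast
  then show thesis using that[of M] adm[of M] M0(1) by simp
qed

section \<open>Solutions with a prescribed fundamental period\<close>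

text \<open>
  The amplitude as a function of \<open>C\<close>: with it, the oscillations above exhaust the profiles with \<open>C > 0\<close>.
\<close>

lemma amplitude_exists:
  fixes a C :: real
  assumes C: "C > 0"
  obtains M where "M > 0" "0 < a + M\<^sup>2 / 6" "(a * M + M^3 / 6) / 2 = C"
proof -
  define h where "h M = M * (a + M\<^sup>2 / 6) / 2" for M
  \<comment> \<open>large enough for \<open>B\<^sup>2/6 \<ge> \<bar>a\<bar> + 2 C\<close>, hence \<open>h B \<ge> C\<close>\<close>
  define B where "B = 6 * (\<bar>a\<bar> + 2 * C) + 1"
  have B: "B \<ge> 1" using C by (simp add: B_def)
  have "(\<bar>a\<bar> + 2 * C) * 1 \<le> (B / 6) * B"
    using C B by (intro mult_mono) (auto simp: B_def)
  then have "2 * C \<le> a + B\<^sup>2 / 6" by (simp add: power2_eq_square)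
  then have "1 * (2 * C) \<le> B * (a + B\<^sup>2 / 6)" using B C by (intro mult_mono) auto
  then have "\<exists>M\<ge>0. M \<le> B \<and> h M = C"
    using C B by (intro IVT') (auto simp: h_def intro!: continuous_intros)
  then obtain M where M: "M \<ge> 0" "h M = C" by blast
  then have "M * (a + M\<^sup>2 / 6) > 0" using C by (simp add: h_def)
  then have "M > 0" "0 < a + M\<^sup>2 / 6" using M(1) by (auto simp: zero_less_mult_iff)
  moreover have "(a * M + M^3 / 6) / 2 = C"
    using M(2) by (simp add: h_def algebra_simps power2_eq_square power3_eq_cube)
  ultimately show thesis using that by blast
qed

lemma periodic_extension_plus: "L > 0 \<Longrightarrow> periodic_extension L u (x + L) = periodic_extension L u x"
  by (simp add: periodic_extension_def rmod_def add_divide_distrib distrib_left)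

text \<open>
  A smaller period \<open>p\<close> would produce a zero at \<open>p\<close>, strictly inside the first oscillation.
\<close>

lemma solution_of_period_exists:
  assumes M: "M > 0" "0 < a + M\<^sup>2 / 6"
  obtains w w1 where "profile_on (wave_period a M) a ((a * M + M^3 / 6) / 2) w w1"
    "nontrivial_solution_with_period_L a (wave_period a M) w"
proof -
  define T where "T = wave_period a M"
  obtain w w1 where w: "\<And>x. (w has_real_derivative w1 x) (at x)"
    "\<And>x. (w1 has_real_derivative (a * M + M^3 / 6) / 2 - a * w x - (w x)^3 / 3) (at x)"
    "w 0 = 0" "w1 0 = 0" "T > 0" "\<And>x. w (x + T) = w x" "\<And>x. w1 (x + T) = w1 x"
    "\<And>x. 0 < x \<Longrightarrow> x < T \<Longrightarrow> w x \<noteq> 0"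
    using oscillation_exists[OF M] unfolding T_def by blast
  have prof: "profile_on T a ((a * M + M^3 / 6) / 2) w w1"
    using w(1-4) by (rule global_profile_on)
  have "is_solution a T w"
    using w(6)[of 0] w(7)[of 0] w(3,4) by (intro profile_imp_solution[OF prof]) auto
  moreover have "nontrivial_on T w"
    unfolding nontrivial_on_def using w(5) w(8)[of "T / 2"] by (intro bexI[of _ "T / 2"]) auto
  moreover have "is_fundamental_period (periodic_extension T w) T"
    unfolding is_fundamental_period_def
  proof (intro conjI allI impI)
    show "periodic_fun_simple (periodic_extension T w) T"
      by standard (rule periodic_extension_plus[OF w(5)])
    fix p :: real
    assume p: "0 < p" and "periodic_fun_simple (periodic_extension T w) p"
    then have per: "periodic_extension T w (0 + p) = periodic_extension T w 0"
      by (intro periodic_fun_simple.plus_period)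
    show "T \<le> p"
    proof (rule ccontr)
      assume "\<not> T \<le> p"
      then show False
        using per p w(3) w(8)[of p] by (simp add: periodic_extension_def)
    qed
  qed (rule w(5))
  ultimately show thesis
    using that prof by (simp add: T_def nontrivial_solution_with_period_L_def)
qed

text \<open>
  The oscillation vanishes only at the multiples of its period \<open>T\<close>, so \<open>v L = 0\<close> means that \<open>L = n T\<close>
  with \<open>n \<ge> 1\<close>. Then the \<open>L\<close>-periodic extension of \<open>v\<close> is the oscillation itself and has period
  \<open>T\<close>, and minimality of \<open>L\<close> excludes \<open>n > 1\<close>.
\<close>

lemma fundamental_period_eq_wave_period:
  assumes M: "M > 0" "0 < a + M\<^sup>2 / 6" and L: "L > 0"
    and prof: "profile_on L a ((a * M + M^3 / 6) / 2) v v1" and vL: "v L = 0"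
    and fund: "is_fundamental_period (periodic_extension L v) L"
  shows "wave_period a M = L"
proof -
  define T where "T = wave_period a M"
  obtain w w1 where w: "\<And>x. (w has_real_derivative w1 x) (at x)"
    "\<And>x. (w1 has_real_derivative (a * M + M^3 / 6) / 2 - a * w x - (w x)^3 / 3) (at x)"
    "w 0 = 0" "w1 0 = 0" "T > 0" "\<And>x. w (x + T) = w x" "\<And>x. w1 (x + T) = w1 x"
    "\<And>x. 0 < x \<Longrightarrow> x < T \<Longrightarrow> w x \<noteq> 0"
    using oscillation_exists[OF M] unfolding T_def by blast
  have "profile_on L a ((a * M + M^3 / 6) / 2) w w1"
    using w(1-4) by (rule global_profile_on)
  note vw = profile_unique[OF prof this]
  interpret w: periodic_fun_simple w T by standard (rule w(6))
  define n where "n = \<lfloor>L / T\<rfloor>"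
  have rmodT: "L rmod T = L - of_int n * T" using w(5) by (simp add: rmod_def n_def mult.commute)
  have "w (L rmod T) = 0"
    unfolding rmodT w.minus_of_int using vw[of L] vL L by simp
  then have "L rmod T = 0"
    using w(8)[of "L rmod T"] rmod_nonneg[of T L] rmod_less[OF w(5), of L] w(5) by linarith
  then have Ln: "L = of_int n * T" by (simp add: rmodT)
  then have "0 < of_int n * T" using L by simp
  then have "n \<ge> 1" using w(5) by (simp add: zero_less_mult_iff)
  then have "1 * T \<le> of_int n * T" using w(5) by (intro mult_right_mono) auto
  then have "T \<le> L" by (simp add: Ln[symmetric])
  have ext: "periodic_extension L v x = w x" for x
  proof -
    have "periodic_extension L v x = w (x rmod L)"
      unfolding periodic_extension_def using L rmod_nonneg[of L x] rmod_le[of L x]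
      by (intro vw) auto
    also have "x rmod L = x - L * of_int \<lfloor>x / L\<rfloor>" using L by (simp add: rmod_def)
    also have "L * of_int \<lfloor>x / L\<rfloor> = of_int (n * \<lfloor>x / L\<rfloor>) * T"
      by (subst Ln) simp
    finally show ?thesis by (simp only: w.minus_of_int)
  qed
  have "periodic_fun_simple (periodic_extension L v) T"
    by standard (simp add: ext w(6))
  then have "L \<le> T" using fund w(5) by (simp add: is_fundamental_period_def)
  with \<open>T \<le> L\<close> show ?thesis by (simp add: T_def)
qed

lemma nontrivial_solution_cong:
  assumes L: "L > 0" and eq: "\<And>x. x \<in> {0..L} \<Longrightarrow> v x = u x"
    and u: "nontrivial_solution_with_period_L a L u"
  shows "nontrivial_solution_with_period_L a L v"
proof -
  have "periodic_extension L v = periodic_extension L u"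
    unfolding periodic_extension_def using L rmod_nonneg[of L] rmod_le[of L]
    by (intro ext eq) auto
  moreover have "is_solution a L v"
  proof -
    obtain u1 u2 u3 where d: "C3_derivatives L u u1 u2 u3"
      and "\<forall>x\<in>{0..L}. u3 x + a * u1 x + (u x)\<^sup>2 * u1 x = 0" "u 0 = 0" "u L = 0" "u1 L = 0"
      using u unfolding nontrivial_solution_with_period_L_def is_solution_def by blast
    moreover have "(v has_real_derivative u1 x) (at x within {0..L})" if "x \<in> {0..L}" for x
    proof (rule has_field_derivative_transform_within)
      show "(u has_real_derivative u1 x) (at x within {0..L})"
        using d that by (simp add: C3_derivatives_def)
      show "(0::real) < 1" by simp
    qed (use that eq in auto)
    then have "C3_derivatives L v u1 u2 u3"
      using d by (simp add: C3_derivatives_def)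
    ultimately show ?thesis
      using L eq unfolding is_solution_def
      by (intro exI[of _ u1] exI[of _ u2] exI[of _ u3]) auto
  qed
  ultimately show ?thesis
    using u eq by (auto simp: nontrivial_solution_with_period_L_def nontrivial_on_def)
qed

lemma nontrivial_solution_uminus:
  assumes L: "L > 0" and u: "nontrivial_solution_with_period_L a L u"
  shows "nontrivial_solution_with_period_L a L (\<lambda>x. - u x)"
proof -
  obtain u1 u2 u3 where "C3_derivatives L u u1 u2 u3"
      "\<forall>x\<in>{0..L}. u3 x + a * u1 x + (u x)\<^sup>2 * u1 x = 0" "u 0 = 0" "u L = 0" "u1 L = 0"
    using u unfolding nontrivial_solution_with_period_L_def is_solution_def by blast
  then have "is_solution a L (\<lambda>x. - u x)"
    unfolding is_solution_def C3_derivatives_def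
    by (intro exI[of _ "\<lambda>x. - u1 x"] exI[of _ "\<lambda>x. - u2 x"] exI[of _ "\<lambda>x. - u3 x"])
      (auto intro!: derivative_eq_intros continuous_intros simp: algebra_simps)
  then show ?thesis
    using u by (simp add: nontrivial_solution_with_period_L_def nontrivial_on_def
        is_fundamental_period_def periodic_extension_def periodic_fun_simple_def)
qed

text \<open>
  The sign of \<open>z\<close> is chosen so that its constant is positive.
\<close>

lemma nontrivial_solution_imp_wave:
  assumes L: "L > 0" and v: "nontrivial_solution_with_period_L a L v"
  obtains M z z1 where "M > 0" "0 < a + M\<^sup>2 / 6" "wave_period a M = L"
    "profile_on L a ((a * M + M^3 / 6) / 2) z z1" "z = v \<or> z = (\<lambda>x. - v x)"
proof -
  have sol: "is_solution a L v" and nontriv: "nontrivial_on L v"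
    using v by (auto simp: nontrivial_solution_with_period_L_def)
  obtain C v1 where prof: "profile_on L a C v v1"
    using solution_imp_profile[OF L sol] .
  have "C \<noteq> 0"
  proof
    assume "C = 0"
    then have "\<forall>x\<in>{0..L}. v x = 0" using profile_unique[OF prof] profile_on_zero[of L a] by blast
    then show False using nontriv by (auto simp: nontrivial_on_def)
  qed
  obtain z z1 where z: "z = v \<or> z = (\<lambda>x. - v x)" "profile_on L a \<bar>C\<bar> z z1"
  proof (cases "C > 0")
    case True
    then show thesis using that[of v v1] prof by simp
  next
    case False
    then show thesis
      using that[of "\<lambda>x. - v x" "\<lambda>x. - v1 x"] profile_on_uminus[OF prof] by simp
  qed
  have "nontrivial_solution_with_period_L a L z"
    using z(1) v nontrivial_solution_uminus[OF L v] by auto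
  then have zL: "z L = 0" "is_fundamental_period (periodic_extension L z) L"
    by (auto simp: nontrivial_solution_with_period_L_def is_solution_def)
  obtain M where M: "M > 0" "0 < a + M\<^sup>2 / 6" "(a * M + M^3 / 6) / 2 = \<bar>C\<bar>"
    using amplitude_exists[of "\<bar>C\<bar>" a] \<open>C \<noteq> 0\<close> by auto
  have prof_M: "profile_on L a ((a * M + M^3 / 6) / 2) z z1" unfolding M(3) by (rule z(2))
  show thesis
    using M(1,2) fundamental_period_eq_wave_period[OF M(1,2) L prof_M zL] prof_M z(1) by (rule that)
qed

theorem theorem2:
  fixes a L :: real
  assumes "L > 0"
  shows "(a * L\<^sup>2 < 4 * pi\<^sup>2 \<longrightarrow>
            (\<exists>u. nontrivial_solution_with_period_L a L u \<and>
                 (\<forall>v. nontrivial_solution_with_period_L a L v \<longleftrightarrow>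
                        (\<forall>x\<in>{0..L}. v x = u x) \<or> (\<forall>x\<in>{0..L}. v x = - u x)))) \<and>
         (a * L\<^sup>2 \<ge> 4 * pi\<^sup>2 \<longrightarrow>
            \<not> (\<exists>u. nontrivial_solution_with_period_L a L u))"
proof (intro conjI impI)
  assume "a * L\<^sup>2 < 4 * pi\<^sup>2"
  then obtain M where M: "M > 0" "0 < a + M\<^sup>2 / 6" "wave_period a M = L"
    using wave_period_surj[OF assms] by blast
  obtain w w1 where prof: "profile_on L a ((a * M + M^3 / 6) / 2) w w1"
      and w: "nontrivial_solution_with_period_L a L w"
    using solution_of_period_exists[OF M(1,2)] unfolding M(3) .
  have unique: "(\<forall>x\<in>{0..L}. v x = w x) \<or> (\<forall>x\<in>{0..L}. v x = - w x)"
    if v: "nontrivial_solution_with_period_L a L v" for v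
  proof -
    obtain N z z1 where N: "N > 0" "0 < a + N\<^sup>2 / 6" "wave_period a N = L"
        "profile_on L a ((a * N + N^3 / 6) / 2) z z1" and z: "z = v \<or> z = (\<lambda>x. - v x)"
      using nontrivial_solution_imp_wave[OF assms v] .
    have "N = M"
      using wave_period_strict_antimono[of M N a] wave_period_strict_antimono[of N M a] M N
      by (cases N M rule: linorder_cases) auto
    then have "z x = w x" if "x \<in> {0..L}" for x
      using profile_unique[OF _ prof that] N(4) by blast
    then show ?thesis using z by force
  qed
  show "\<exists>u. nontrivial_solution_with_period_L a L u \<and>
      (\<forall>v. nontrivial_solution_with_period_L a L v \<longleftrightarrow>
        (\<forall>x\<in>{0..L}. v x = u x) \<or> (\<forall>x\<in>{0..L}. v x = - u x))"
    using w unique nontrivial_solution_cong[OF assms _ w]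
      nontrivial_solution_cong[OF assms _ nontrivial_solution_uminus[OF assms w]]
    by blast
next
  assume supercritical: "4 * pi\<^sup>2 \<le> a * L\<^sup>2"
  show "\<not> (\<exists>u. nontrivial_solution_with_period_L a L u)"
  proof
    assume "\<exists>u. nontrivial_solution_with_period_L a L u"
    then obtain u where "nontrivial_solution_with_period_L a L u" ..
    with assms obtain M where "M > 0" "0 < a + M\<^sup>2 / 6" "wave_period a M = L"
      by (rule nontrivial_solution_imp_wave)
    then show False using wave_period_bound[of M a] supercritical by simp
  qed
qed

end
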